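(* There is an absolute constant $C>0$ and an algorithm that, given any instance of the Multiplicative Bidding Problem, outputs a feasible multiplicative bid whose value is at least $\mathrm{OPT}/(C\sqrt{n})$.
   Context: An instance of the Multiplicative Bidding Problem consists of integers $m,n\ge 1$ ($n$ is the number of columns), prices $p_{ij}>0$ and values $v_{ij}\ge 0$ for every cell $(i,j)\in[m]\times[n]$, and a budget $B>0$. A multiplicative bid consists of nonnegative reals $r_1,\dots,r_m$ and $c_1,\dots,c_n$; cell $(i,j)$ is captured if $r_i c_j\ge p_{ij}$. The bid is feasible if the total price of captured cells is at most $B$, and its value is the total value of captured cells. $\mathrm{OPT}$ (individual bidding optimum): order all cells by nonincreasing $v_{ij}/p_{ij}$ (ties broken arbitrarily) and take the longest prefix with total price at most $B$; $\mathrm{OPT}$ denotes this set of cells and also its total value. *)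

theory Defs
  imports Complex_Main
begin

section \<open>The Multiplicative Bidding Problem\<close>

text \<open>
  Rows and columns are numbered from \<open>0\<close>.  Only the entries of \<open>price\<close> and \<open>val\<close> inside the
  \<open>num_rows \<times> num_cols\<close> grid are part of the instance; see \<open>input_state\<close> below.
\<close>

record mbp =
  num_rows :: nat
  num_cols :: nat
  price :: "nat \<Rightarrow> nat \<Rightarrow> real"
  val :: "nat \<Rightarrow> nat \<Rightarrow> real"
  budget :: real

definition mbp_instance :: "mbp \<Rightarrow> bool" where
  "mbp_instance I \<longleftrightarrow>
     num_rows I \<ge> 1 \<and> num_cols I \<ge> 1 \<and> budget I > 0 \<and>
     (\<forall>i<num_rows I. \<forall>j<num_cols I. price I i j > 0 \<and> val I i j \<ge> 0)"

definition cells :: "mbp \<Rightarrow> (nat \<times> nat) set" where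
  "cells I = {..<num_rows I} \<times> {..<num_cols I}"

definition total_price :: "mbp \<Rightarrow> (nat \<times> nat) set \<Rightarrow> real" where
  "total_price I S = (\<Sum>(i, j)\<in>S. price I i j)"

definition total_val :: "mbp \<Rightarrow> (nat \<times> nat) set \<Rightarrow> real" where
  "total_val I S = (\<Sum>(i, j)\<in>S. val I i j)"

definition multiplicative_bid :: "mbp \<Rightarrow> (nat \<Rightarrow> real) \<Rightarrow> (nat \<Rightarrow> real) \<Rightarrow> bool" where
  "multiplicative_bid I r c \<longleftrightarrow> (\<forall>i<num_rows I. r i \<ge> 0) \<and> (\<forall>j<num_cols I. c j \<ge> 0)"

definition captured :: "mbp \<Rightarrow> (nat \<Rightarrow> real) \<Rightarrow> (nat \<Rightarrow> real) \<Rightarrow> (nat \<times> nat) set" where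
  "captured I r c = {(i, j) \<in> cells I. r i * c j \<ge> price I i j}"

definition feasible_bid :: "mbp \<Rightarrow> (nat \<Rightarrow> real) \<Rightarrow> (nat \<Rightarrow> real) \<Rightarrow> bool" where
  "feasible_bid I r c \<longleftrightarrow>
     multiplicative_bid I r c \<and> total_price I (captured I r c) \<le> budget I"

definition bid_value :: "mbp \<Rightarrow> (nat \<Rightarrow> real) \<Rightarrow> (nat \<Rightarrow> real) \<Rightarrow> real" where
  "bid_value I r c = total_val I (captured I r c)"


subsection \<open>The individual bidding optimum\<close>

text \<open>
  Ties are resolved by the choice of the ordering \<open>cs\<close>, so the optimum depends on \<open>cs\<close>.
\<close>

definition density :: "mbp \<Rightarrow> nat \<times> nat \<Rightarrow> real" where
  "density I = (\<lambda>(i, j). val I i j / price I i j)"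

definition density_ordering :: "mbp \<Rightarrow> (nat \<times> nat) list \<Rightarrow> bool" where
  "density_ordering I cs \<longleftrightarrow>
     distinct cs \<and> set cs = cells I \<and> sorted_wrt (\<lambda>x y. density I x \<ge> density I y) cs"

definition OPT_set :: "mbp \<Rightarrow> (nat \<times> nat) list \<Rightarrow> (nat \<times> nat) set" where
  "OPT_set I cs =
     set (take (Max {k. k \<le> length cs \<and> total_price I (set (take k cs)) \<le> budget I}) cs)"

definition OPT :: "mbp \<Rightarrow> (nat \<times> nat) list \<Rightarrow> real" where
  "OPT I cs = total_val I (OPT_set I cs)"


section \<open>Algorithms: programs for the real RAM\<close>

text \<open>
  Since prices, values and bids are real numbers, an algorithm is a program for the real RAM,
  presented as a structured imperative language.  A program is a finite piece of syntax that does
  not depend on the instance.  The memory consists of natural number variables and of arrays of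
  reals indexed by natural numbers.  Reals admit exact arithmetic and comparison, but there is no
  conversion from reals to naturals (in particular no floor function), and the only constants are
  natural numbers, so no information can be hidden in a real constant.  Operators have their HOL
  meaning: subtraction and division of naturals truncate, and dividing by zero gives zero.
\<close>

datatype nexp =
    NConst nat
  | NVar string
  | NAdd nexp nexp
  | NSub nexp nexp
  | NMul nexp nexp
  | NDiv nexp nexp

datatype rexp =
    RNat nexp
  | RArr string nexp
  | RAdd rexp rexp
  | RSub rexp rexp
  | RMul rexp rexp
  | RDiv rexp rexp

datatype bexp =
    NLe nexp nexp
  | RLe rexp rexp
  | BNot bexp
  | BAnd bexp bexp

datatype prog =
    Skip
  | NAssign string nexp
  | RAssign string nexp rexp  \<comment> \<open>array, index, new entry\<close>
  | Seq prog prog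
  | Cond bexp prog prog
  | While bexp prog

record state =
  nats :: "string \<Rightarrow> nat"
  arrs :: "string \<Rightarrow> nat \<Rightarrow> real"

primrec nval :: "nexp \<Rightarrow> state \<Rightarrow> nat" where
  "nval (NConst k) s = k"
| "nval (NVar x) s = nats s x"
| "nval (NAdd a b) s = nval a s + nval b s"
| "nval (NSub a b) s = nval a s - nval b s"
| "nval (NMul a b) s = nval a s * nval b s"
| "nval (NDiv a b) s = nval a s div nval b s"

primrec rval :: "rexp \<Rightarrow> state \<Rightarrow> real" where
  "rval (RNat a) s = real (nval a s)"
| "rval (RArr A a) s = arrs s A (nval a s)"
| "rval (RAdd a b) s = rval a s + rval b s"
| "rval (RSub a b) s = rval a s - rval b s"
| "rval (RMul a b) s = rval a s * rval b s"
| "rval (RDiv a b) s = rval a s / rval b s"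

primrec bval :: "bexp \<Rightarrow> state \<Rightarrow> bool" where
  "bval (NLe a b) s \<longleftrightarrow> nval a s \<le> nval b s"
| "bval (RLe a b) s \<longleftrightarrow> rval a s \<le> rval b s"
| "bval (BNot b) s \<longleftrightarrow> \<not> bval b s"
| "bval (BAnd b b') s \<longleftrightarrow> bval b s \<and> bval b' s"

text \<open>\<open>exec P s t\<close>: the program \<open>P\<close>, started in \<open>s\<close>, terminates in \<open>t\<close>.\<close>

inductive exec :: "prog \<Rightarrow> state \<Rightarrow> state \<Rightarrow> bool" where
  exec_Skip: "exec Skip s s"
| exec_NAssign: "exec (NAssign x a) s (s\<lparr>nats := (nats s)(x := nval a s)\<rparr>)"
| exec_RAssign:
    "exec (RAssign A a e) s (s\<lparr>arrs := (arrs s)(A := (arrs s A)(nval a s := rval e s))\<rparr>)"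
| exec_Seq: "exec P s t \<Longrightarrow> exec Q t u \<Longrightarrow> exec (Seq P Q) s u"
| exec_CondT: "bval b s \<Longrightarrow> exec P s t \<Longrightarrow> exec (Cond b P Q) s t"
| exec_CondF: "\<not> bval b s \<Longrightarrow> exec Q s t \<Longrightarrow> exec (Cond b P Q) s t"
| exec_WhileF: "\<not> bval b s \<Longrightarrow> exec (While b P) s s"
| exec_WhileT:
    "bval b s \<Longrightarrow> exec P s t \<Longrightarrow> exec (While b P) t u \<Longrightarrow> exec (While b P) s u"

inductive_cases exec_SkipE: "exec Skip s t"
inductive_cases exec_NAssignE: "exec (NAssign x a) s t"
inductive_cases exec_RAssignE: "exec (RAssign A a e) s t"
inductive_cases exec_SeqE: "exec (Seq P Q) s t"
inductive_cases exec_CondE: "exec (Cond b P Q) s t"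
inductive_cases exec_WhileE: "exec (While b P) s t"

text \<open>
  Programs are deterministic, so a program has at most one output on each input.
\<close>

lemma exec_deterministic: "exec P s t \<Longrightarrow> exec P s u \<Longrightarrow> u = t"
proof (induction arbitrary: u rule: exec.induct)
  case (exec_WhileT b s P t u)
  then show ?case by (metis exec_WhileE)
qed (blast elim: exec_SkipE exec_NAssignE exec_RAssignE exec_SeqE exec_CondE exec_WhileE)+

text \<open>
  The price and value matrices are stored row by row, and all memory that is not part of the
  input is zero.  The bid is read off the arrays \<open>r\<close> and \<open>c\<close> of the final state.
\<close>

definition input_matrix :: "nat \<Rightarrow> nat \<Rightarrow> (nat \<Rightarrow> nat \<Rightarrow> real) \<Rightarrow> nat \<Rightarrow> real" where
  "input_matrix m n M = (\<lambda>k. if k < m * n then M (k div n) (k mod n) else 0)"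

definition input_state :: "mbp \<Rightarrow> state" where
  "input_state I =
     \<lparr>nats = (\<lambda>_. 0)(''m'' := num_rows I, ''n'' := num_cols I),
      arrs = (\<lambda>_ _. 0)(
        ''p'' := input_matrix (num_rows I) (num_cols I) (price I),
        ''v'' := input_matrix (num_rows I) (num_cols I) (val I),
        ''B'' := (\<lambda>_. 0)(0 := budget I))\<rparr>"

definition outputs_bid :: "prog \<Rightarrow> mbp \<Rightarrow> (nat \<Rightarrow> real) \<Rightarrow> (nat \<Rightarrow> real) \<Rightarrow> bool" where
  "outputs_bid P I r c \<longleftrightarrow>
     (\<exists>t. exec P (input_state I) t \<and> r = arrs t ''r'' \<and> c = arrs t ''c'')"

end

theory Submission
  imports Defs
begin

text \<open>
  Let \<open>S\<close> be any set of cells of price at most \<open>B\<close> and value \<open>w\<close>.  Choose a random set \<open>T\<close> of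
  columns, each with probability \<open>q = 1 / sqrt n\<close>, bid \<open>1\<close> on \<open>T\<close> and \<open>0\<close> elsewhere, and bid on
  each row the largest price of a cell of \<open>S\<close> in that row and in \<open>T\<close>.  The cells of \<open>S\<close> captured
  have expected value \<open>q w\<close>.  A cell of \<open>S\<close> of price \<open>p\<close> is responsible for at most \<open>n\<close> further
  cells of price at most \<open>p\<close>, so the expected price is at most \<open>q B + q\<^sup>2 n B \<le> 2 B\<close>.  Hence for some
  \<open>T\<close> the value minus \<open>q w / (4 B)\<close> times the price is at least \<open>q w / 2\<close>.  Rows can be dropped
  independently, so a knapsack argument over the rows yields a feasible bid of value at least
  \<open>q w / 8\<close>, unless a single row carries value \<open>q w / 4\<close>; then the cells of \<open>S\<close> in that row and in
  \<open>T\<close> can be captured exactly.  All these bids use only the numbers \<open>0\<close>, \<open>1\<close> and the prices, so an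
  exhaustive search, with bids coded by the digits of a natural number, finds one at least as good.
\<close>

section \<open>Total correctness of real RAM programs\<close>

text \<open>Since \<open>exec\<close> is deterministic, one terminating run ending in
  \<open>Q\<close> is total correctness. The equations below therefore compute weakest preconditions
  by rewriting; only loops need a genuine rule.\<close>

definition tc :: "prog \<Rightarrow> (state \<Rightarrow> bool) \<Rightarrow> state \<Rightarrow> bool" where
  "tc P Q s \<longleftrightarrow> (\<exists>t. exec P s t \<and> Q t)"

lemma tc_Skip [simp]: "tc Skip Q s \<longleftrightarrow> Q s"
  unfolding tc_def by (blast intro: exec_Skip elim: exec_SkipE)

lemma tc_NAssign [simp]:
  "tc (NAssign x a) Q s \<longleftrightarrow> Q (s\<lparr>nats := (nats s)(x := nval a s)\<rparr>)"
  unfolding tc_def by (blast intro: exec_NAssign elim: exec_NAssignE)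

lemma tc_RAssign [simp]:
  "tc (RAssign A a e) Q s \<longleftrightarrow>
     Q (s\<lparr>arrs := (arrs s)(A := (arrs s A)(nval a s := rval e s))\<rparr>)"
  unfolding tc_def by (blast intro: exec_RAssign elim: exec_RAssignE)

lemma tc_Seq [simp]: "tc (Seq P R) Q s \<longleftrightarrow> tc P (tc R Q) s"
  unfolding tc_def by (blast intro: exec_Seq elim: exec_SeqE)

lemma tc_Cond [simp]: "tc (Cond b P R) Q s \<longleftrightarrow> (if bval b s then tc P Q s else tc R Q s)"
  unfolding tc_def by (auto intro: exec_CondT exec_CondF elim: exec_CondE)

lemma tc_While_False: "\<not> bval b s \<Longrightarrow> Q s \<Longrightarrow> tc (While b P) Q s"
  unfolding tc_def by (blast intro: exec_WhileF)

lemma tc_While_True: "bval b s \<Longrightarrow> tc P (tc (While b P) Q) s \<Longrightarrow> tc (While b P) Q s"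
  unfolding tc_def by (blast intro: exec_WhileT)

lemma tc_mono: "tc P Q s \<Longrightarrow> (\<And>t. Q t \<Longrightarrow> R t) \<Longrightarrow> tc P R s"
  unfolding tc_def by blast

definition For :: "string \<Rightarrow> nexp \<Rightarrow> prog \<Rightarrow> prog" where
  "For x a P = Seq (NAssign x (NConst 0))
     (While (NLe (NAdd (NVar x) (NConst 1)) a)
        (Seq P (NAssign x (NAdd (NVar x) (NConst 1)))))"

text \<open>Downward induction on the distance of the counter from \<open>N\<close>. The loop
  re-evaluates its bound in every round, so the invariant has to fix the value of \<open>a\<close>;
  the body must return the counter unchanged, and the increment is absorbed into the step from
  \<open>k\<close> to \<open>Suc k\<close>.\<close>

lemma tc_For:
  assumes init: "Inv 0 (s\<lparr>nats := (nats s)(x := 0)\<rparr>)"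
    and step: "\<And>k t. k < N \<Longrightarrow> Inv k t \<Longrightarrow> nats t x = k \<Longrightarrow>
      tc P (\<lambda>u. nats u x = k \<and> Inv (Suc k) (u\<lparr>nats := (nats u)(x := Suc k)\<rparr>)) t"
    and bound: "\<And>k t. Inv k t \<Longrightarrow> nval a t = N"
    and final: "\<And>t. Inv N t \<Longrightarrow> Q t"
  shows "tc (For x a P) Q s"
proof -
  let ?W = "While (NLe (NAdd (NVar x) (NConst 1)) a)
        (Seq P (NAssign x (NAdd (NVar x) (NConst 1))))"
  have "tc ?W Q t" if "k \<le> N" "Inv k t" "nats t x = k" for k t
    using that
  proof (induction k arbitrary: t rule: inc_induct)
    case base
    then show ?case
      using bound[of N t] final by (intro tc_While_False) auto
  next
    case (step k)
    show ?case
    proof (rule tc_While_True)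
      show "bval (NLe (NAdd (NVar x) (NConst 1)) a) t"
        using step bound[of k t] by simp
      show "tc (Seq P (NAssign x (NAdd (NVar x) (NConst 1)))) (tc ?W Q) t"
        unfolding tc_Seq
        by (rule tc_mono[OF assms(2)[OF step.hyps(2) step.prems]]) (use step.IH in simp)
    qed
  qed
  from this[of 0] init show ?thesis by (simp add: For_def)
qed

text \<open>Frame condition: \<open>X\<close> and \<open>Y\<close> collect what a program may
  overwrite. Variables and arrays have separate name spaces, so \<open>best\<close> can be both a
  variable (the code) and an array (its value).\<close>

definition agree_off :: "string set \<Rightarrow> string set \<Rightarrow> state \<Rightarrow> state \<Rightarrow> bool" where
  "agree_off X Y s t \<longleftrightarrow>
     (\<forall>x. x \<notin> X \<longrightarrow> nats t x = nats s x) \<and> (\<forall>A. A \<notin> Y \<longrightarrow> arrs t A = arrs s A)"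


section \<open>The exhaustive search\<close>

definition nmod :: "nexp \<Rightarrow> nexp \<Rightarrow> nexp" where
  "nmod a b = NSub a (NMul (NDiv a b) b)"

lemma nval_nmod [simp]: "nval (nmod a b) s = nval a s mod nval b s"
  by (simp add: nmod_def minus_div_mult_eq_mod)

text \<open>Each round consumes two digits of \<open>x\<close> in base \<open>b\<close>: the first
  selects an entry of the price array as row bid, the second is itself the column bid. The bound
  \<open>m + n\<close> lets one loop cover all rows and all columns.\<close>

definition decode :: prog where
  "decode = For ''i'' (NAdd (NVar ''m'') (NVar ''n''))
     (Seq (RAssign ''r'' (NVar ''i'') (RArr ''p'' (nmod (NVar ''x'') (NVar ''b''))))
     (Seq (NAssign ''x'' (NDiv (NVar ''x'') (NVar ''b'')))
     (Seq (RAssign ''c'' (NVar ''i'') (RNat (nmod (NVar ''x'') (NVar ''b''))))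
          (NAssign ''x'' (NDiv (NVar ''x'') (NVar ''b''))))))"

definition evaluate :: prog where
  "evaluate = Seq (RAssign ''cost'' (NConst 0) (RNat (NConst 0)))
     (Seq (RAssign ''value'' (NConst 0) (RNat (NConst 0)))
     (For ''k'' (NMul (NVar ''m'') (NVar ''n''))
       (Cond (RLe (RArr ''p'' (NVar ''k''))
           (RMul (RArr ''r'' (NDiv (NVar ''k'') (NVar ''n'')))
                 (RArr ''c'' (nmod (NVar ''k'') (NVar ''n'')))))
         (Seq (RAssign ''cost'' (NConst 0)
                (RAdd (RArr ''cost'' (NConst 0)) (RArr ''p'' (NVar ''k''))))
              (RAssign ''value'' (NConst 0)
                (RAdd (RArr ''value'' (NConst 0)) (RArr ''v'' (NVar ''k'')))))
         Skip)))"

definition set_base :: prog where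
  "set_base = Seq (NAssign ''b'' (NAdd (NMul (NVar ''m'') (NVar ''n'')) (NConst 1)))
     (Seq (NAssign ''size'' (NConst 1))
     (For ''i'' (NAdd (NVar ''m'') (NVar ''n''))
       (NAssign ''size'' (NMul (NVar ''size'') (NMul (NVar ''b'') (NVar ''b''))))))"

definition try_code :: prog where
  "try_code = Seq (NAssign ''x'' (NVar ''K'')) (Seq decode (Seq evaluate
     (Cond (BAnd (RLe (RArr ''cost'' (NConst 0)) (RArr ''B'' (NConst 0)))
                 (BNot (RLe (RArr ''value'' (NConst 0)) (RArr ''best'' (NConst 0)))))
       (Seq (RAssign ''best'' (NConst 0) (RArr ''value'' (NConst 0)))
            (NAssign ''best'' (NVar ''K'')))
       Skip)))"

text \<open>Later trials overwrite \<open>r\<close> and \<open>c\<close>, so the winning code is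
  remembered and decoded once more at the end.\<close>

definition search :: prog where
  "search = Seq set_base (Seq (For ''K'' (NVar ''size'') try_code)
     (Seq (NAssign ''x'' (NVar ''best'')) decode))"

lemma tc_decode:
  "tc decode (\<lambda>t. agree_off {''i'', ''x''} {''r'', ''c''} s t \<and>
     (\<forall>j < nats s ''m'' + nats s ''n''.
        arrs t ''r'' j = arrs s ''p'' (nats s ''x'' div nats s ''b'' ^ (2 * j) mod nats s ''b'') \<and>
        arrs t ''c'' j = real (nats s ''x'' div nats s ''b'' ^ (2 * j + 1) mod nats s ''b''))) s"
  unfolding decode_def
proof (rule tc_For[where N = "nats s ''m'' + nats s ''n''" and Inv = "\<lambda>k t.
    agree_off {''i'', ''x''} {''r'', ''c''} s t \<and> 
    nats t ''x'' = nats s ''x'' div nats s ''b'' ^ (2 * k) \<and>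
    (\<forall>j < k.
        arrs t ''r'' j = arrs s ''p'' (nats s ''x'' div nats s ''b'' ^ (2 * j) mod nats s ''b'') \<and>
        arrs t ''c'' j = real (nats s ''x'' div nats s ''b'' ^ (2 * j + 1) mod nats s ''b''))"], goal_cases)
  case (2 k t)
  have "a div c div b = a div (b * c)" for a b c :: nat
    by (metis div_mult2_eq mult.commute)
  with 2 show ?case
    by (auto simp: agree_off_def less_Suc_eq)
qed (auto simp: agree_off_def)

lemma tc_evaluate:
  fixes s :: state
  defines "hit \<equiv> \<lambda>k. arrs s ''p'' k \<le>
    arrs s ''r'' (k div nats s ''n'') * arrs s ''c'' (k mod nats s ''n'')"
  shows "tc evaluate (\<lambda>t. agree_off {''k''} {''cost'', ''value''} s t \<and>
     arrs t ''cost'' 0 = (\<Sum>k < nats s ''m'' * nats s ''n''. if hit k then arrs s ''p'' k else 0) \<and>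
     arrs t ''value'' 0 = (\<Sum>k < nats s ''m'' * nats s ''n''. if hit k then arrs s ''v'' k else 0)) s"
  unfolding evaluate_def tc_Seq tc_RAssign
proof (rule tc_For[where N = "nats s ''m'' * nats s ''n''" and Inv = "\<lambda>k t.
    agree_off {''k''} {''cost'', ''value''} s t \<and>
     arrs t ''cost'' 0 = (\<Sum>k<k. if hit k then arrs s ''p'' k else 0) \<and>
     arrs t ''value'' 0 = (\<Sum>k<k. if hit k then arrs s ''v'' k else 0)"], goal_cases)
  case (2 k t)
  then show ?case
    by (auto simp: agree_off_def hit_def)
qed (auto simp: agree_off_def)

lemma tc_set_base:
  "tc set_base (\<lambda>t. agree_off {''b'', ''size'', ''i''} {} s t \<and>
     nats t ''b'' = nats s ''m'' * nats s ''n'' + 1 \<and>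
     nats t ''size'' = nats t ''b'' ^ (2 * (nats s ''m'' + nats s ''n''))) s"
proof -
  define b where "b = nats s ''m'' * nats s ''n'' + 1"
  show ?thesis
    unfolding set_base_def tc_Seq tc_NAssign b_def[symmetric]
  proof (rule tc_For[where N = "nats s ''m'' + nats s ''n''" and Inv = "\<lambda>k t.
      agree_off {''b'', ''size'', ''i''} {} s t \<and>
       nats t ''b'' = b \<and> nats t ''size'' = b ^ (2 * k)"], goal_cases)
    case 1
    then show ?case by (auto simp: agree_off_def b_def)
  next
    case (2 k t)
    then show ?case by (auto simp: agree_off_def)
  qed (auto simp: agree_off_def)
qed

section \<open>Bids as digit codes, and correctness of the search\<close>

definition base :: "mbp \<Rightarrow> nat" where
  "base I = num_rows I * num_cols I + 1"

text \<open>
  Even digits of \<open>K\<close> index the price array; the largest digit points just past its end and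
  yields the bid \<open>0\<close>.
\<close>

definition row_bid :: "mbp \<Rightarrow> nat \<Rightarrow> nat \<Rightarrow> real" where
  "row_bid I K i = input_matrix (num_rows I) (num_cols I) (price I) (K div base I ^ (2 * i) mod base I)"

definition col_bid :: "mbp \<Rightarrow> nat \<Rightarrow> nat \<Rightarrow> real" where
  "col_bid I K j = real (K div base I ^ (2 * j + 1) mod base I)"

lemma captured_cong:
  assumes "\<And>i. i < num_rows I \<Longrightarrow> r i = r' i" "\<And>j. j < num_cols I \<Longrightarrow> c j = c' j"
  shows "captured I r c = captured I r' c'"
  using assms by (auto simp: captured_def cells_def)

lemma sum_row_major:
  fixes f :: "nat \<Rightarrow> nat \<Rightarrow> real"
  shows "(\<Sum>k < m * n. f (k div n) (k mod n)) = (\<Sum>(i, j) \<in> {..<m} \<times> {..<n}. f i j)"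
proof (cases "n = 0")
  case False
  have "(\<Sum>k < m * n. f (k div n) (k mod n)) = (\<Sum>i<m. \<Sum>k = i * n..<i * n + n. f (k div n) (k mod n))"
    by (simp add: sum.nat_group)
  also have "\<dots> = (\<Sum>i<m. \<Sum>j<n. f i j)"
  proof (rule sum.cong[OF refl])
    fix i
    have "(\<Sum>k = i * n..<i * n + n. f (k div n) (k mod n))
      = (\<Sum>j = 0..<n. f ((j + i * n) div n) ((j + i * n) mod n))"
      using sum.shift_bounds_nat_ivl[of "\<lambda>k. f (k div n) (k mod n)" 0 "i * n" n]
      by (simp add: add.commute)
    also have "\<dots> = (\<Sum>j<n. f i j)"
      using False by (intro sum.cong) auto
    finally show "(\<Sum>k = i * n..<i * n + n. f (k div n) (k mod n)) = (\<Sum>j<n. f i j)" .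
  qed
  finally show ?thesis by (simp add: sum.cartesian_product)
qed auto

text \<open>Identifies the totals accumulated by \<open>evaluate\<close> over the flat arrays with
  sums over captured cells, via the row-major enumeration of the grid.\<close>

lemma sum_captured:
  fixes f :: "nat \<Rightarrow> nat \<Rightarrow> real"
  shows "(\<Sum>k < num_rows I * num_cols I.
       if input_matrix (num_rows I) (num_cols I) (price I) k \<le> r (k div num_cols I) * c (k mod num_cols I)
       then input_matrix (num_rows I) (num_cols I) f k else 0)
     = (\<Sum>(i, j) \<in> captured I r c. f i j)"
proof -
  have "(\<Sum>(i, j) \<in> captured I r c. f i j) =
     (\<Sum>x \<in> cells I. if price I (fst x) (snd x) \<le> r (fst x) * c (snd x) then f (fst x) (snd x) else 0)"
    unfolding captured_def
    by (subst sum.inter_filter[symmetric]) (auto simp: cells_def intro!: sum.cong)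
  also have "\<dots> = (\<Sum>(i, j) \<in> {..<num_rows I} \<times> {..<num_cols I}. if price I i j \<le> r i * c j then f i j else 0)"
    by (auto simp: cells_def intro!: sum.cong)
  also have "\<dots> = (\<Sum>k < num_rows I * num_cols I.
       if price I (k div num_cols I) (k mod num_cols I) \<le> r (k div num_cols I) * c (k mod num_cols I)
       then f (k div num_cols I) (k mod num_cols I) else 0)"
    by (rule sum_row_major[symmetric])
  finally show ?thesis
    by (auto simp: input_matrix_def intro!: sum.cong)
qed

definition code_capture :: "mbp \<Rightarrow> nat \<Rightarrow> (nat \<times> nat) set" where
  "code_capture I K = captured I (row_bid I K) (col_bid I K)"

definition holds_instance :: "mbp \<Rightarrow> state \<Rightarrow> bool" where
  "holds_instance I s \<longleftrightarrow> nats s ''m'' = num_rows I \<and> nats s ''n'' = num_cols I \<and>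
     nats s ''b'' = base I \<and>
     arrs s ''p'' = input_matrix (num_rows I) (num_cols I) (price I) \<and>
     arrs s ''v'' = input_matrix (num_rows I) (num_cols I) (val I) \<and>
     arrs s ''B'' 0 = budget I"

definition best_code :: "mbp \<Rightarrow> nat \<Rightarrow> nat \<Rightarrow> bool" where
  "best_code I N K \<longleftrightarrow> total_price I (code_capture I K) \<le> budget I \<and>
     (\<forall>K'<N. total_price I (code_capture I K') \<le> budget I \<longrightarrow>
        total_val I (code_capture I K') \<le> total_val I (code_capture I K))"

lemma tc_try_code:
  assumes s: "holds_instance I s"
  shows "tc try_code (\<lambda>t. agree_off {''x'', ''i'', ''k'', ''best''}
        {''r'', ''c'', ''cost'', ''value'', ''best''} s t \<and>
     (if total_price I (code_capture I (nats s ''K'')) \<le> budget I \<and>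
         arrs s ''best'' 0 < total_val I (code_capture I (nats s ''K''))
      then nats t ''best'' = nats s ''K'' \<and>
         arrs t ''best'' 0 = total_val I (code_capture I (nats s ''K''))
      else nats t ''best'' = nats s ''best'' \<and> arrs t ''best'' 0 = arrs s ''best'' 0)) s"
  unfolding try_code_def tc_Seq tc_NAssign
proof (rule tc_mono[OF tc_decode], rule tc_mono[OF tc_evaluate], goal_cases)
  case (1 t u)
  define K where "K = nats s ''K''"
  have t: "holds_instance I t"
    and rc: "\<And>j. j < num_rows I + num_cols I \<Longrightarrow> arrs t ''r'' j = row_bid I K j"
      "\<And>j. j < num_rows I + num_cols I \<Longrightarrow> arrs t ''c'' j = col_bid I K j"
    using 1(1) s by (auto simp: agree_off_def holds_instance_def row_bid_def col_bid_def K_def)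
  have "captured I (arrs t ''r'') (arrs t ''c'') = code_capture I K"
    unfolding code_capture_def using rc by (intro captured_cong) auto
  then have "arrs u ''cost'' 0 = total_price I (code_capture I K)"
    "arrs u ''value'' 0 = total_val I (code_capture I K)"
    using 1(2) t sum_captured[of I "arrs t ''r''" "arrs t ''c''"]
    by (auto simp: holds_instance_def total_price_def total_val_def cong: if_cong)
  moreover have "arrs u ''B'' 0 = budget I" "nats u ''K'' = K" "nats u ''best'' = nats s ''best''"
    "arrs u ''best'' = arrs s ''best''"
    using 1 s by (auto simp: agree_off_def holds_instance_def K_def)
  moreover have "agree_off {''x'', ''i'', ''k'', ''best''}
        {''r'', ''c'', ''cost'', ''value'', ''best''} s u"
    using 1 by (auto simp: agree_off_def)
  ultimately show ?case
    by (auto simp: K_def[symmetric] agree_off_def)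
qed

text \<open>All column bids are zero and prices are positive. Hence the zeroed initial memory is a
  valid incumbent: code \<open>0\<close>, feasible, with value \<open>0\<close>.\<close>

lemma code_capture_0: "mbp_instance I \<Longrightarrow> code_capture I 0 = {}"
  by (auto simp: code_capture_def captured_def col_bid_def cells_def mbp_instance_def not_le)

lemma search_correct:
  assumes I: "mbp_instance I"
  obtains r c K where "outputs_bid search I r c" "best_code I (base I ^ (2 * (num_rows I + num_cols I))) K"
    "\<And>i. i < num_rows I \<Longrightarrow> r i = row_bid I K i" "\<And>j. j < num_cols I \<Longrightarrow> c j = col_bid I K j"
proof -
  define N where "N = base I ^ (2 * (num_rows I + num_cols I))"
  have "tc search (\<lambda>t. \<exists>K. best_code I N K \<and>
     (\<forall>j < num_rows I + num_cols I. arrs t ''r'' j = row_bid I K j \<and> arrs t ''c'' j = col_bid I K j))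
     (input_state I)"
    unfolding search_def tc_Seq tc_NAssign
  proof (rule tc_mono[OF tc_set_base], goal_cases)
    case (1 t0)
    have b: "nats t0 ''b'' = base I"
      using 1 by (simp add: base_def input_state_def)
    have "nats t0 ''size'' = N"
      using 1 by (simp add: b N_def input_state_def)
    with b 1 have t0: "holds_instance I t0" "nats t0 ''size'' = N" "nats t0 ''best'' = 0"
      "arrs t0 ''best'' 0 = 0"
      by (auto simp: agree_off_def input_state_def holds_instance_def)
    \<comment> \<open>After \<open>K\<close> rounds the incumbent is optimal among the codes below
      \<open>K\<close>, and the array \<open>best\<close> caches its value.\<close>
    let ?Inv = "\<lambda>K t. holds_instance I t \<and> nats t ''size'' = N \<and>
        best_code I K (nats t ''best'') \<and>
        arrs t ''best'' 0 = total_val I (code_capture I (nats t ''best''))"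
    show ?case
    proof (rule tc_For[where N = N and Inv = ?Inv], goal_cases)
      case 1
      then show ?case
        using t0 I
        by (auto simp: holds_instance_def best_code_def code_capture_0 total_price_def total_val_def
          mbp_instance_def)
    next
      case (2 K t)
      then have "holds_instance I t" by simp
      from tc_try_code[OF this] show ?case
      proof (rule tc_mono)
        fix u assume u: "agree_off {''x'', ''i'', ''k'', ''best''}
            {''r'', ''c'', ''cost'', ''value'', ''best''} t u \<and>
          (if total_price I (code_capture I (nats t ''K'')) \<le> budget I \<and>
              arrs t ''best'' 0 < total_val I (code_capture I (nats t ''K''))
           then nats u ''best'' = nats t ''K'' \<and>
              arrs u ''best'' 0 = total_val I (code_capture I (nats t ''K''))
           else nats u ''best'' = nats t ''best'' \<and> arrs u ''best'' 0 = arrs t ''best'' 0)"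
        then have frame: "holds_instance I u" "nats u ''size'' = N" "nats u ''K'' = K"
          using 2 by (auto simp: agree_off_def holds_instance_def)
        moreover have "best_code I (Suc K) (nats u ''best'') \<and>
            arrs u ''best'' 0 = total_val I (code_capture I (nats u ''best''))"
        proof (cases "total_price I (code_capture I K) \<le> budget I \<and>
            arrs t ''best'' 0 < total_val I (code_capture I K)")
          case True
          then have "nats u ''best'' = K" "arrs u ''best'' 0 = total_val I (code_capture I K)"
            using u 2(3) by auto
          then show ?thesis
            using True 2(2) unfolding best_code_def less_Suc_eq by fastforce
        next
          case False
          then have "nats u ''best'' = nats t ''best''" "arrs u ''best'' 0 = arrs t ''best'' 0"
            using u 2(3) by auto
          then show ?thesis
            using False 2(2) unfolding best_code_def less_Suc_eq by auto
        qed
        ultimately show "nats u ''K'' = K \<and> ?Inv (Suc K) (u\<lparr>nats := (nats u)(''K'' := Suc K)\<rparr>)"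
          by (simp add: holds_instance_def)
      qed
    next
      case (3 k t)
      then show ?case by simp
    next
      case (4 t)
      show ?case
        by (rule tc_mono[OF tc_decode], rule exI[of _ "nats t ''best''"])
          (use 4 in \<open>simp add: holds_instance_def row_bid_def col_bid_def\<close>)
    qed
  qed
  then obtain t K where t: "exec search (input_state I) t" "best_code I N K"
    "\<And>j. j < num_rows I + num_cols I \<Longrightarrow> arrs t ''r'' j = row_bid I K j \<and> arrs t ''c'' j = col_bid I K j"
    unfolding tc_def by blast
  show thesis
  proof (rule that)
    show "outputs_bid search I (arrs t ''r'') (arrs t ''c'')"
      using t(1) unfolding outputs_bid_def by blast
    show "best_code I (base I ^ (2 * (num_rows I + num_cols I))) K"
      using t(2) by (simp only: N_def)
  qed (simp_all add: t(3))
qed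

section \<open>The search space contains every bid built from prices, \<open>0\<close> and
  \<open>1\<close>\<close>

lemma code_exists:
  fixes d :: "nat \<Rightarrow> nat"
  assumes "\<And>i. d i < b"
  shows "\<exists>K < b ^ N. \<forall>i < N. K div b ^ i mod b = d i"
  using assms
proof (induction N arbitrary: d)
  case (Suc N)
  from Suc.IH[of "\<lambda>i. d (Suc i)"] Suc.prems obtain K where
    K: "K < b ^ N" "\<And>i. i < N \<Longrightarrow> K div b ^ i mod b = d (Suc i)" by blast
  have b: "0 < b" using Suc.prems[of 0] by simp
  \<comment> \<open>Horner's rule: shift the number with the digits \<open>d 1\<close>,
    \<open>d 2\<close>, ... by one place and add \<open>d 0\<close>.\<close>
  have "d 0 + b * K < b * Suc K" using Suc.prems[of 0] by simp
  also have "\<dots> \<le> b * b ^ N" using K(1) by (intro mult_le_mono2) simp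
  finally have "d 0 + b * K < b ^ Suc N" by simp
  moreover have "(d 0 + b * K) div b ^ i mod b = d i" if "i < Suc N" for i
  proof (cases i)
    case 0
    then show ?thesis using Suc.prems[of 0] by simp
  next
    case (Suc k)
    then show ?thesis
      using K(2)[of k] that b Suc.prems[of 0] by (simp add: div_mult2_eq)
  qed
  ultimately show ?case by blast
qed simp

lemma code_of_bid:
  assumes I: "mbp_instance I"
    and r: "\<And>i. i < num_rows I \<Longrightarrow> r i = 0 \<or> (\<exists>j < num_cols I. r i = price I i j)"
    and c: "\<And>j. j < num_cols I \<Longrightarrow> c j \<in> {0, 1}"
  shows "\<exists>K < base I ^ (2 * (num_rows I + num_cols I)). code_capture I K = captured I r c"
proof -
  let ?m = "num_rows I" and ?n = "num_cols I"
  \<comment> \<open>With at least one cell the base is at least 2, so \<open>1\<close> is available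
    as a column digit.\<close>
  have mn: "?m * ?n \<ge> 1" using I by (simp add: mbp_instance_def)
  \<comment> \<open>A positive row bid is coded by the row-major position of its price. Everything
    else gets the digit \<open>?m * ?n\<close>, the first position past the matrix, where
    \<open>input_matrix\<close> is \<open>0\<close>.\<close>
  have "\<exists>d < base I. i < ?m \<longrightarrow> input_matrix ?m ?n (price I) d = r i" for i
  proof (cases "i < ?m \<and> r i \<noteq> 0")
    case True
    with r obtain j where j: "j < ?n" "r i = price I i j" by blast
    have "i * ?n + j < Suc i * ?n" using j by simp
    also have "\<dots> \<le> ?m * ?n" using True by (intro mult_le_mono1) simp
    finally show ?thesis
      using j by (intro exI[of _ "i * ?n + j"]) (auto simp: base_def input_matrix_def)
  next
    case False
    then show ?thesis
      by (intro exI[of _ "?m * ?n"]) (auto simp: base_def input_matrix_def)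
  qed
  then obtain d where d: "\<And>i. d i < base I"
    "\<And>i. i < ?m \<Longrightarrow> input_matrix ?m ?n (price I) (d i) = r i" by metis
  define e where "e i = (if even i then d (i div 2) else if c (i div 2) = 1 then 1 else 0)" for i
  have "e i < base I" for i
    using d(1) mn by (auto simp: e_def base_def)
  from code_exists[of e, OF this, of "2 * (?m + ?n)"] obtain K where
    K: "K < base I ^ (2 * (?m + ?n))" "\<And>i. i < 2 * (?m + ?n) \<Longrightarrow> K div base I ^ i mod base I = e i"
    by blast
  have "code_capture I K = captured I r c"
    unfolding code_capture_def
  proof (rule captured_cong)
    show "row_bid I K i = r i" if "i < ?m" for i
      using that K(2)[of "2 * i"] d(2) by (simp add: row_bid_def e_def)
    show "col_bid I K j = c j" if "j < ?n" for j
      using that K(2)[of "2 * j + 1"] c[OF that] by (auto simp: col_bid_def e_def)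
  qed
  with K(1) show ?thesis by blast
qed


section \<open>Existence of a good bid\<close>

text \<open>
  The right-hand side is the expectation of the left-hand side for a random set \<open>T\<close> that contains
  each element independently with probability \<open>q\<close>.
\<close>

lemma quadratic_subset:
  fixes a :: "'a \<Rightarrow> real" and b :: "'a \<Rightarrow> 'a \<Rightarrow> real" and q :: real
  assumes "finite A" "0 \<le> q" "q \<le> 1"
  shows "\<exists>T \<subseteq> A. (\<Sum>j\<in>T. a j) - (\<Sum>j\<in>T. \<Sum>k\<in>T - {j}. b j k)
     \<ge> q * (\<Sum>j\<in>A. a j) - q\<^sup>2 * (\<Sum>j\<in>A. \<Sum>k\<in>A - {j}. b j k)"
  using assms(1)
proof (induction A arbitrary: a)
  case empty
  then show ?case by simp
next
  case (insert x A)
  define E where "E T = (\<Sum>j\<in>T. \<Sum>k\<in>T - {j}. b j k)" for T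
  \<comment> \<open>Once \<open>x\<close> is in the set, its pair terms with each other
    \<open>j\<close> become linear and are absorbed into the coefficient of \<open>j\<close>; this
    is why the induction generalises over \<open>a\<close>.\<close>
  define a' where "a' j = a j - b j x - b x j" for j
  have E: "E (insert x T) = E T + (\<Sum>j\<in>T. b j x + b x j)" if "T \<subseteq> A" for T
  proof -
    have T: "finite T" "x \<notin> T" using insert.hyps that by (auto intro: finite_subset)
    have "(\<Sum>k\<in>insert x T - {j}. b j k) = b j x + (\<Sum>k\<in>T - {j}. b j k)" if "j \<in> T" for j
    proof -
      have "insert x T - {j} = insert x (T - {j})" using that T by auto
      then show ?thesis using T by simp
    qed
    then show ?thesis
      using T by (simp add: E_def sum.distrib)
  qed
  \<comment> \<open>Method of conditional expectations: \<open>g\<close> and \<open>g'\<close> are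
    the expectations given that \<open>x\<close> is left out or put in. The full expectation is
    their average with weights \<open>1 - q\<close> and \<open>q\<close>, so one of them is at least
    as large.\<close>
  define g where "g = q * (\<Sum>j\<in>A. a j) - q\<^sup>2 * E A"
  define g' where "g' = a x + (q * (\<Sum>j\<in>A. a' j) - q\<^sup>2 * E A)"
  have "q * (\<Sum>j\<in>insert x A. a j) - q\<^sup>2 * E (insert x A) = q * g' + (1 - q) * g"
    using insert.hyps
    by (simp add: E[OF subset_refl] g_def g'_def a'_def sum.distrib sum_subtractf algebra_simps
      power2_eq_square)
  also have "\<dots> \<le> max g' g"
    using assms(2,3) by (intro convex_bound_le) auto
  finally consider "q * (\<Sum>j\<in>insert x A. a j) - q\<^sup>2 * E (insert x A) \<le> g"
    | "q * (\<Sum>j\<in>insert x A. a j) - q\<^sup>2 * E (insert x A) \<le> g'"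
    by (auto simp: max_def split: if_splits)
  then show ?case
  proof cases
    case 1
    from insert.IH[of a] obtain T where "T \<subseteq> A" "(\<Sum>j\<in>T. a j) - E T \<ge> g"
      unfolding g_def E_def by blast
    with 1 show ?thesis
      unfolding E_def[symmetric] by (intro exI[of _ T]) auto
  next
    case 2
    from insert.IH[of a'] obtain T where T: "T \<subseteq> A" "a x + ((\<Sum>j\<in>T. a' j) - E T) \<ge> g'"
      unfolding g'_def E_def by auto
    have "(\<Sum>j\<in>insert x T. a j) - E (insert x T) = a x + ((\<Sum>j\<in>T. a' j) - E T)"
      using T(1) insert.hyps finite_subset[OF T(1)]
      by (subst sum.insert) (auto simp: E[OF T(1)] a'_def sum.distrib sum_subtractf)
    with 2 T show ?thesis
      unfolding E_def[symmetric] by (intro exI[of _ "insert x T"]) auto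
  qed
qed

text \<open>Keep only the items with \<open>l * y i \<le> x i\<close> and take a maximal affordable
  set \<open>R\<close> of them. If \<open>R\<close> is everything, discarding items of negative net
  gain has only helped. Otherwise one more item \<open>i\<close> pushes the cost above
  \<open>B\<close>, so \<open>R\<close> and \<open>i\<close> together gain more than
  \<open>l * B\<close> and one of them has half; \<open>i\<close> alone is affordable because
  \<open>l * y i \<le> x i < l * B\<close>.\<close>

lemma knapsack_half:
  fixes x y :: "'a \<Rightarrow> real"
  assumes fin: "finite M" and y: "\<And>i. i \<in> M \<Longrightarrow> 0 \<le> y i"
    and pos: "0 < l" "0 < B"
    and small: "\<And>i. i \<in> M \<Longrightarrow> x i < l * B"
    and total: "(\<Sum>i\<in>M. x i - l * y i) \<ge> l * B / 2"
  shows "\<exists>R \<subseteq> M. sum y R \<le> B \<and> l * B / 2 \<le> sum x R"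
proof -
  define M' where "M' = {i \<in> M. l * y i \<le> x i}"
  have M': "finite M'" "M' \<subseteq> M" using fin by (auto simp: M'_def)
  have dense: "l * sum y R \<le> sum x R" if "R \<subseteq> M'" for R
    using that by (auto simp: sum_distrib_left M'_def intro!: sum_mono)
  let ?F = "{R \<in> Pow M'. sum y R \<le> B}"
  have "\<exists>R\<in>?F. \<forall>R'\<in>?F. R \<subseteq> R' \<longrightarrow> R = R'"
    using M' pos by (intro finite_has_maximal) auto
  then obtain R where R: "R \<subseteq> M'" "sum y R \<le> B"
    and max: "\<And>R'. R' \<subseteq> M' \<Longrightarrow> sum y R' \<le> B \<Longrightarrow> R \<subseteq> R' \<Longrightarrow> R = R'"
    by auto
  show ?thesis
  proof (cases "R = M'")
    case True
    have "(\<Sum>i\<in>M. x i - l * y i) \<le> (\<Sum>i\<in>M'. x i - l * y i)"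
      using fin M' by (intro sum_mono2[of M "M'" "\<lambda>i. - (x i - l * y i)", simplified sum_negf, simplified])
        (auto simp: M'_def)
    also have "\<dots> \<le> sum x M'"
      using M' y pos by (intro sum_mono) (auto simp: M'_def)
    finally show ?thesis using True R M' total by (intro exI[of _ R]) auto
  next
    case False
    then obtain i where i: "i \<in> M'" "i \<notin> R" using R by blast
    have "\<not> sum y (insert i R) \<le> B" using max[of "insert i R"] i R by auto
    then have "B < sum y (insert i R)" by simp
    then have "l * B < l * sum y (insert i R)" using pos by simp
    also have "\<dots> \<le> sum x (insert i R)" using i R by (intro dense) auto
    also have "\<dots> = x i + sum x R" using i finite_subset[OF R(1) M'(1)] by simp
    finally consider "l * B / 2 \<le> x i" | "l * B / 2 \<le> sum x R" by linarith
    then show ?thesis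
    proof cases
      case 1
      have "l * y i < l * B" using i small[of i] by (auto simp: M'_def)
      then have "y i \<le> B" using pos by simp
      with 1 i M' show ?thesis by (intro exI[of _ "{i}"]) auto
    next
      case 2
      with R M' show ?thesis by blast
    qed
  qed
qed

lemma good_bid_exists:
  fixes S :: "(nat \<times> nat) set"
  assumes I: "mbp_instance I" and S: "S \<subseteq> cells I" "total_price I S \<le> budget I"
  shows "\<exists>r c. (\<forall>i < num_rows I. r i = 0 \<or> (\<exists>j < num_cols I. r i = price I i j)) \<and>
    (\<forall>j < num_cols I. c j \<in> {0, 1}) \<and> total_price I (captured I r c) \<le> budget I \<and>
    total_val I S / (8 * sqrt (real (num_cols I))) \<le> total_val I (captured I r c)"
proof (cases "total_val I S = 0")
  case True
  have "captured I (\<lambda>_. 0) (\<lambda>_. 0) = {}"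
    using I by (auto simp: captured_def cells_def mbp_instance_def not_le)
  with True I show ?thesis
    by (intro exI[of _ "\<lambda>_. 0"]) (auto simp: total_price_def total_val_def mbp_instance_def)
next
  case False
  define m n p v B w where defs: "m = num_rows I" "n = num_cols I" "p = price I" "v = val I"
    "B = budget I" "w = total_val I S"
  have mn: "1 \<le> m" "1 \<le> n" and B: "0 < B" and p: "\<And>i j. i < m \<Longrightarrow> j < n \<Longrightarrow> 0 < p i j"
    and v: "\<And>i j. i < m \<Longrightarrow> j < n \<Longrightarrow> 0 \<le> v i j"
    using I by (auto simp: mbp_instance_def defs)
  define s where "s i = {j. j < n \<and> (i, j) \<in> S}" for i
  have s: "s i \<subseteq> {..<n}" "finite (s i)" for i by (auto simp: s_def)
  have p_s: "0 \<le> p i j" if "i < m" "j \<in> s i" for i j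
    using p[of i j] that by (auto simp: s_def)
  have S_eq: "S = Sigma {..<m} s" using S(1) by (auto simp: s_def cells_def defs)
  have sum_S: "(\<Sum>(i, j)\<in>S. f i j) = (\<Sum>i<m. \<Sum>j\<in>s i. f i j)" for f :: "nat \<Rightarrow> nat \<Rightarrow> real"
    unfolding S_eq by (subst sum.Sigma) (auto simp: s)
  have "0 \<le> w" unfolding defs total_val_def
    using S(1) I by (auto simp: cells_def mbp_instance_def intro!: sum_nonneg)
  with False have w: "0 < w" by (simp add: defs)
  define q where "q = 1 / sqrt n"
  have q: "0 < q" "q \<le> 1" "q\<^sup>2 * n = 1"
    using mn by (auto simp: q_def power_divide)
  \<comment> \<open>The multiplier charges the expected price, at most \<open>2 * B\<close>, with
    exactly half of the expected gain \<open>q * w\<close>.\<close>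
  define l where "l = w * q / (4 * B)"
  have l: "0 < l" "l * B = q * w / 4" using w q B by (auto simp: l_def field_simps)

  \<comment> \<open>\<open>a j\<close> is the penalised value of the cells of \<open>S\<close> in
    column \<open>j\<close>. \<open>b j k\<close> is the penalty for the cells of column
    \<open>k\<close> that come along when each row bids its price in column \<open>j\<close>, summed
    over the rows with a cell of \<open>S\<close> there.\<close>
  define a where "a j = (\<Sum>i | i < m \<and> j \<in> s i. v i j - l * p i j)" for j
  define b where "b j k = l * (\<Sum>i | i < m \<and> j \<in> s i. if p i k \<le> p i j then p i k else 0)" for j k
  have swap: "(\<Sum>j\<in>T. \<Sum>i | i < m \<and> j \<in> s i. f i j) = (\<Sum>i<m. \<Sum>j\<in>s i \<inter> T. f i j)"
    if "finite T" for T and f :: "nat \<Rightarrow> nat \<Rightarrow> real"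
  proof -
    have "(\<Sum>j\<in>T. \<Sum>i | i < m \<and> j \<in> s i. f i j) = (\<Sum>j\<in>T. \<Sum>i\<in>{i\<in>{..<m}. j \<in> s i}. f i j)"
      by (simp add: lessThan_def)
    also have "\<dots> = (\<Sum>i<m. \<Sum>j\<in>{j\<in>T. j \<in> s i}. f i j)"
      using that by (intro sum.swap_restrict) auto
    also have "\<dots> = (\<Sum>i<m. \<Sum>j\<in>s i \<inter> T. f i j)"
      by (intro sum.cong) auto
    finally show ?thesis .
  qed
  have swap_b: "(\<Sum>j\<in>T. \<Sum>k\<in>T - {j}. b j k) =
      l * (\<Sum>i<m. \<Sum>j\<in>s i \<inter> T. \<Sum>k\<in>T - {j}. if p i k \<le> p i j then p i k else 0)"
    if "finite T" for T
    unfolding b_def sum_distrib_left[symmetric]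
    by (subst sum.swap) (simp add: swap[OF that, symmetric])
  have s_Int: "s i \<inter> {..<n} = s i" for i using s by auto
  have price_S: "(\<Sum>i<m. \<Sum>j\<in>s i. p i j) \<le> B"
    using S(2) sum_S[of p] by (simp add: total_price_def defs)
  have val_S: "(\<Sum>i<m. \<Sum>j\<in>s i. v i j) = w"
    using sum_S[of v] by (simp add: total_val_def defs)
  have "(\<Sum>j<n. a j) = w - l * (\<Sum>i<m. \<Sum>j\<in>s i. p i j)"
    unfolding a_def by (simp add: swap s_Int sum_subtractf sum_distrib_left val_S)
  also have "\<dots> \<ge> w - l * B" using price_S l by simp
  finally have a_total: "w - l * B \<le> (\<Sum>j<n. a j)" .
  have "(\<Sum>j<n. \<Sum>k\<in>{..<n} - {j}. b j k)
      \<le> l * (\<Sum>i<m. \<Sum>j\<in>s i. \<Sum>k<n. p i j)"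
    unfolding swap_b[OF finite_lessThan] s_Int
  proof (intro mult_left_mono sum_mono)
    fix i j assume ij: "i \<in> {..<m}" "j \<in> s i"
    then have pij: "0 \<le> p i j" using p_s by simp
    have "(\<Sum>k\<in>{..<n} - {j}. if p i k \<le> p i j then p i k else 0) \<le> (\<Sum>k\<in>{..<n} - {j}. p i j)"
      using pij by (intro sum_mono) auto
    also have "\<dots> \<le> (\<Sum>k<n. p i j)"
      using pij by (intro sum_mono2) auto
    finally show "(\<Sum>k\<in>{..<n} - {j}. if p i k \<le> p i j then p i k else 0) \<le> (\<Sum>k<n. p i j)" .
  qed (use l in auto)
  also have "\<dots> = l * n * (\<Sum>i<m. \<Sum>j\<in>s i. p i j)"
    by (simp add: sum_distrib_left mult.assoc)
  also have "\<dots> \<le> l * n * B"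
    using price_S l by (intro mult_left_mono) auto
  finally have b_total: "(\<Sum>j<n. \<Sum>k\<in>{..<n} - {j}. b j k) \<le> l * n * B" .
  \<comment> \<open>Each loss is bounded by one \<open>l * B\<close>: the linear one because
    \<open>q \<le> 1\<close>, the quadratic one because \<open>q\<^sup>2 * n = 1\<close>, which is
    what dictates \<open>q = 1 / sqrt n\<close>.\<close>
  have "q * w / 2 = q * w - l * B - l * B" by (simp add: l)
  also have "\<dots> \<le> q * w - q * (l * B) - q\<^sup>2 * (l * n * B)"
  proof -
    have "q * (l * B) \<le> l * B" using q l B by (intro mult_left_le_one_le) auto
    moreover have "q\<^sup>2 * (l * n * B) = (q\<^sup>2 * n) * (l * B)" by (simp only: mult_ac)
    ultimately show ?thesis unfolding q(3) by linarith
  qed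
  also have "\<dots> = q * (w - l * B) - q\<^sup>2 * (l * n * B)" by (simp add: algebra_simps)
  also have "\<dots> \<le> q * (\<Sum>j<n. a j) - q\<^sup>2 * (\<Sum>j<n. \<Sum>k\<in>{..<n} - {j}. b j k)"
    using a_total b_total q by (intro diff_mono mult_left_mono) auto
  finally have "q * w / 2 \<le> \<dots>" .
  moreover obtain T where T: "T \<subseteq> {..<n}"
    and "q * (\<Sum>j<n. a j) - q\<^sup>2 * (\<Sum>j<n. \<Sum>k\<in>{..<n} - {j}. b j k)
      \<le> (\<Sum>j\<in>T. a j) - (\<Sum>j\<in>T. \<Sum>k\<in>T - {j}. b j k)"
    using quadratic_subset[OF finite_lessThan less_imp_le[OF q(1)] q(2), of n a b] by blast
  ultimately have T_val: "q * w / 2 \<le> (\<Sum>j\<in>T. a j) - (\<Sum>j\<in>T. \<Sum>k\<in>T - {j}. b j k)"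
    by linarith
  have fin_T: "finite T" using T by (rule finite_subset) simp

  \<comment> \<open>A row without a cell of \<open>S\<close> in \<open>T\<close> bids
    \<open>0\<close> and captures nothing, as prices are positive. \<open>G i\<close> lists all
    columns captured in row \<open>i\<close>, including those of cells outside
    \<open>S\<close>.\<close>
  define rb where "rb i = (if s i \<inter> T = {} then 0 else Max (p i ` (s i \<inter> T)))" for i
  define G where "G i = {j \<in> T. p i j \<le> rb i}" for i
  define cost gain where "cost i = (\<Sum>j\<in>G i. p i j)" and "gain i = (\<Sum>j\<in>s i \<inter> T. v i j)" for i
  have rb: "rb i = 0 \<or> (\<exists>j<n. rb i = p i j)" for i
  proof (cases "s i \<inter> T = {}")
    case False
    then have "rb i \<in> p i ` (s i \<inter> T)" using s by (auto simp: rb_def intro!: Max_in)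
    with T show ?thesis by auto
  qed (simp add: rb_def)
  have sT_G: "s i \<inter> T \<subseteq> G i" for i
    using s by (auto simp: G_def rb_def)
  have fin_G: "finite (G i)" for i using fin_T by (simp add: G_def)
  \<comment> \<open>The bid of the row is the price of a single cell \<open>j\<close> of
    \<open>S\<close>; the term of that \<open>j\<close> alone equals the cost of the row, and the
    other terms are nonnegative.\<close>
  have cost_bound: "cost i \<le> (\<Sum>j\<in>s i \<inter> T. p i j + (\<Sum>k\<in>T - {j}. if p i k \<le> p i j then p i k else 0))"
    (is "_ \<le> sum ?f _") if i: "i < m" for i
  proof -
    have f_nonneg: "0 \<le> ?f j" if "j \<in> T" for j
      using i p T that by (intro add_nonneg_nonneg sum_nonneg) (auto intro: less_imp_le)
    show ?thesis
    proof (cases "s i \<inter> T = {}")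
      case True
      then have "G i = {}" using p[OF i] T by (fastforce simp: G_def rb_def)
      then show ?thesis using True by (simp add: cost_def)
    next
      case False
      then have "rb i \<in> p i ` (s i \<inter> T)" using s by (auto simp: rb_def intro!: Max_in)
      then obtain j where j: "j \<in> s i \<inter> T" "rb i = p i j" by auto
      have "cost i = (\<Sum>k\<in>T. if p i k \<le> p i j then p i k else 0)"
        unfolding cost_def G_def using fin_T j by (simp add: sum.inter_filter)
      also have "\<dots> = ?f j" using fin_T j by (subst sum.remove[of T j]) auto
      also have "\<dots> \<le> sum ?f (s i \<inter> T)"
        using j f_nonneg fin_T by (intro member_le_sum) auto
      finally show ?thesis .
    qed
  qed
  have "(\<Sum>j\<in>T. a j) - (\<Sum>j\<in>T. \<Sum>k\<in>T - {j}. b j k) = (\<Sum>i<m. gain i - l *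
      (\<Sum>j\<in>s i \<inter> T. p i j + (\<Sum>k\<in>T - {j}. if p i k \<le> p i j then p i k else 0)))"
    unfolding a_def swap[OF fin_T] swap_b[OF fin_T] gain_def
    by (simp add: sum_subtractf sum.distrib sum_distrib_left distrib_left)
  also have "\<dots> \<le> (\<Sum>i<m. gain i - l * cost i)"
    using cost_bound l by (intro sum_mono) auto
  finally have net_gain: "q * w / 2 \<le> (\<Sum>i<m. gain i - l * cost i)"
    using T_val by linarith

  have block: "captured I (\<lambda>i. if i \<in> R then rho i else 0) (\<lambda>j. if j \<in> U then 1 else 0)
      = Sigma R (\<lambda>i. {j \<in> U. p i j \<le> rho i})" if "R \<subseteq> {..<m}" "U \<subseteq> {..<n}" for R U rho
  proof -
    let ?r = "\<lambda>i. if i \<in> R then rho i else 0" and ?c = "\<lambda>j. if j \<in> U then 1 else 0 :: real"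
    have hit: "p i j \<le> ?r i * ?c j \<longleftrightarrow> i \<in> R \<and> j \<in> U \<and> p i j \<le> rho i" if "i < m" "j < n" for i j
      using p[OF that] by simp
    have "captured I ?r ?c = {(i, j). i < m \<and> j < n \<and> p i j \<le> ?r i * ?c j}"
      unfolding captured_def cells_def defs by simp
    also have "\<dots> = {(i, j). i < m \<and> j < n \<and> i \<in> R \<and> j \<in> U \<and> p i j \<le> rho i}"
      by (simp only: hit cong: conj_cong)
    also have "\<dots> = Sigma R (\<lambda>i. {j \<in> U. p i j \<le> rho i})"
      using that by auto
    finally show ?thesis .
  qed
  have sum_block: "(\<Sum>(i, j)\<in>Sigma R H. f i j) = (\<Sum>i\<in>R. \<Sum>j\<in>H i. f i j)"
    if "R \<subseteq> {..<m}" "\<And>i. finite (H i)" for R H and f :: "nat \<Rightarrow> nat \<Rightarrow> real"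
    using that finite_subset[OF that(1)] by (subst sum.Sigma) auto
  \<comment> \<open>Common end of both cases: keep the rows \<open>R\<close> and the columns
    \<open>U\<close>. The target \<open>l * B / 2\<close> equals \<open>q * w / 8\<close>, the
    source of the constant 8.\<close>
  have goal: "?thesis" if "R \<subseteq> {..<m}" "U \<subseteq> T"
    and price_le: "(\<Sum>i\<in>R. \<Sum>j | j \<in> U \<and> p i j \<le> rb i. p i j) \<le> B"
    and val_ge: "l * B / 2 \<le> (\<Sum>i\<in>R. \<Sum>j | j \<in> U \<and> p i j \<le> rb i. v i j)" for R U
  proof -
    let ?r = "\<lambda>i. if i \<in> R then rb i else 0" and ?c = "\<lambda>j. if j \<in> U then 1 else 0 :: real"
    have U: "U \<subseteq> {..<n}" "finite U" using that(2) T fin_T by (auto intro: finite_subset)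
    have cap: "captured I ?r ?c = Sigma R (\<lambda>i. {j \<in> U. p i j \<le> rb i})"
      using that(1) U by (intro block) auto
    have "total_price I (captured I ?r ?c) \<le> budget I"
      unfolding total_price_def cap using that(1) U price_le
      by (subst sum_block) (auto simp: defs)
    moreover have "l * B / 2 \<le> total_val I (captured I ?r ?c)"
      unfolding total_val_def cap using that(1) U val_ge
      by (subst sum_block) (auto simp: defs)
    moreover have "l * B / 2 = total_val I S / (8 * sqrt (real (num_cols I)))"
      unfolding l by (simp add: q_def defs)
    ultimately show ?thesis
      using rb by (intro exI[of _ ?r] exI[of _ ?c]) (auto simp: defs q_def)
  qed
  show ?thesis
  proof (cases "\<exists>i<m. l * B \<le> gain i")
    case True
    then obtain i where i: "i < m" "l * B \<le> gain i" by blast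
    \<comment> \<open>One row is rich enough by itself. Shrinking the columns to
      \<open>s i \<inter> T\<close> makes the bid capture only cells of \<open>S\<close>, whose
      price is within the budget.\<close>
    have eq: "{j \<in> s i \<inter> T. p i j \<le> rb i} = s i \<inter> T"
      using sT_G[of i] by (auto simp: G_def)
    have "(\<Sum>j\<in>s i \<inter> T. p i j) \<le> (\<Sum>j\<in>s i. p i j)"
      using i p_s s by (intro sum_mono2) auto
    also have "\<dots> \<le> (\<Sum>i<m. \<Sum>j\<in>s i. p i j)"
      using i p_s by (intro member_le_sum[of i "{..<m}" "\<lambda>i. \<Sum>j\<in>s i. p i j"]) (auto intro!: sum_nonneg)
    also note price_S
    finally have le_B: "(\<Sum>j\<in>s i \<inter> T. p i j) \<le> B" .
    have "0 < l * B" using l(1) B by simp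
    with i have "l * B / 2 \<le> gain i" by linarith
    then show ?thesis
      using i le_B by (intro goal[of "{i}" "s i \<inter> T"]) (auto simp: eq[simplified] gain_def)
  next
    case False
    have cost_nonneg: "0 \<le> cost i" if "i < m" for i
      using p[OF that, THEN less_imp_le] T by (auto simp: cost_def G_def intro!: sum_nonneg)
    have "0 < l * B" using l(1) B by simp
    then have "l * B / 2 \<le> (\<Sum>i<m. gain i - l * cost i)"
      using net_gain l by linarith
    with knapsack_half[of "{..<m}" cost l B gain] False l B cost_nonneg
    obtain R where R: "R \<subseteq> {..<m}" "sum cost R \<le> B" "l * B / 2 \<le> sum gain R"
      by (auto simp: not_le)
    \<comment> \<open>\<open>gain\<close> counts only cells of \<open>S\<close>; further captured
      cells have nonnegative value.\<close>
    have "sum gain R \<le> (\<Sum>i\<in>R. \<Sum>j\<in>G i. v i j)"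
      unfolding gain_def using R(1) v T sT_G fin_G
      by (intro sum_mono sum_mono2) (auto simp: G_def)
    with R show ?thesis
      by (intro goal[of R T]) (auto simp: cost_def G_def)
  qed
qed

section \<open>The individual optimum as the set \<open>S\<close>, and the final guarantee\<close>

lemma OPT_set_affordable:
  assumes "mbp_instance I" "density_ordering I cs"
  shows "OPT_set I cs \<subseteq> cells I" "total_price I (OPT_set I cs) \<le> budget I"
proof -
  let ?F = "{k. k \<le> length cs \<and> total_price I (set (take k cs)) \<le> budget I}"
  have "finite ?F" by (rule finite_subset[of _ "{..length cs}"]) auto
  \<comment> \<open>The empty prefix is affordable, so the maximum is taken over a nonempty
    set.\<close>
  moreover have "0 \<in> ?F" using assms(1) by (simp add: total_price_def mbp_instance_def)
  ultimately have "Max ?F \<in> ?F" by (intro Max_in) auto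
  then show "total_price I (OPT_set I cs) \<le> budget I" by (simp add: OPT_set_def)
  show "OPT_set I cs \<subseteq> cells I"
    using assms(2) set_take_subset[of _ cs] by (auto simp: OPT_set_def density_ordering_def)
qed

theorem theorem1:
  "\<exists>C::real. C > 0 \<and>
     (\<exists>algorithm::prog. \<forall>I. mbp_instance I \<longrightarrow>
        (\<exists>r c. outputs_bid algorithm I r c \<and> feasible_bid I r c \<and>
           (\<forall>cs. density_ordering I cs \<longrightarrow>
              bid_value I r c \<ge> OPT I cs / (C * sqrt (real (num_cols I))))))"
proof (intro exI[of _ 8] exI[of _ search] conjI allI impI)
  fix I assume I: "mbp_instance I"
  obtain r c K where out: "outputs_bid search I r c"
    and best: "best_code I (base I ^ (2 * (num_rows I + num_cols I))) K"
    and rc: "\<And>i. i < num_rows I \<Longrightarrow> r i = row_bid I K i" "\<And>j. j < num_cols I \<Longrightarrow> c j = col_bid I K j"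
    by (rule search_correct[OF I]) blast
  have cap: "captured I r c = code_capture I K"
    unfolding code_capture_def using rc by (rule captured_cong)
  have "0 \<le> row_bid I K i" for i
  proof -
    define k where "k = K div base I ^ (2 * i) mod base I"
    have "0 \<le> price I (k div num_cols I) (k mod num_cols I)" if "k < num_rows I * num_cols I"
      using that I by (auto simp: mbp_instance_def less_mult_imp_div_less intro: less_imp_le)
    then show ?thesis by (simp add: row_bid_def input_matrix_def flip: k_def)
  qed
  then have "feasible_bid I r c"
    using best rc by (auto simp: feasible_bid_def multiplicative_bid_def best_code_def cap col_bid_def)
  moreover have "OPT I cs / (8 * sqrt (real (num_cols I))) \<le> bid_value I r c"
    if cs: "density_ordering I cs" for cs
  proof -
    \<comment> \<open>The comparison bid may depend on the tie-breaking \<open>cs\<close>, but the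
      output does not: it is at least as good as every coded feasible bid.\<close>
    from good_bid_exists[OF I OPT_set_affordable[OF I cs]] obtain r' c' where
      r'c': "\<forall>i < num_rows I. r' i = 0 \<or> (\<exists>j < num_cols I. r' i = price I i j)"
      "\<forall>j < num_cols I. c' j \<in> {0, 1}" "total_price I (captured I r' c') \<le> budget I"
      and val: "OPT I cs / (8 * sqrt (real (num_cols I))) \<le> total_val I (captured I r' c')"
      unfolding OPT_def by blast
    from code_of_bid[OF I, of r' c'] r'c' obtain K' where
      "K' < base I ^ (2 * (num_rows I + num_cols I))" "code_capture I K' = captured I r' c'"
      by blast
    with best r'c'(3) have "total_val I (captured I r' c') \<le> total_val I (code_capture I K)"
      unfolding best_code_def by metis
    with val show ?thesis by (simp add: bid_value_def cap)
  qed
  ultimately show "\<exists>r c. outputs_bid search I r c \<and> feasible_bid I r c \<and>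
           (\<forall>cs. density_ordering I cs \<longrightarrow>
              bid_value I r c \<ge> OPT I cs / (8 * sqrt (real (num_cols I))))"
    using out by blast
qed simp

end
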